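(* Let $N$ be a timelike ruled surface of type $N_-$ in $\mathbb{R}_1^3$ with timelike striction curve $\vec c$ and curvatures $k_1,k_2$, and let $N^\alpha$ be an $\alpha$-transversal surface of $N$ whose striction curve $\vec c_\alpha$ coincides with $\vec c$. Then $\vec c$ is a geodesic on $N$ if and only if there exists a constant $x\in\mathbb{R}$ such that $\alpha'=xk_2-k_1$ on $I$.
   Context: $\mathbb{R}_1^3$ is Minkowski 3-space with metric $\langle\cdot,\cdot\rangle=-dx_1^2+dx_2^2+dx_3^2$. A nonzero vector $\vec v$ is timelike if $\langle\vec v,\vec v\rangle<0$, null if $\langle\vec v,\vec v\rangle=0$, spacelike if $\langle\vec v,\vec v\rangle>0$. Setting. All functions are smooth on an open interval $I$. A timelike ruled surface of type $N_-$ with timelike striction curve is $\vec r(s,v)=\vec c(s)+v\vec q(s)$, with ruling direction $\vec q$ unit timelike, where $\vec c$ is its striction curve, a timelike curve parametrized by arc length $s$. It has a Frenet frame $\{\vec q,\vec h,\vec a\}$ of mutually orthogonal vectors, $\langle\vec q,\vec q\rangle=-1$, $\langle\vec h,\vec h\rangle=\langle\vec a,\vec a\rangle=1$ ($\vec h$ is the central normal, i.e. the surface normal along $\vec c$; $\vec a$ the central tangent), with $\vec q\,'=k_1\vec h$, $\vec h'=k_1\vec q+k_2\vec a$, $\vec a'=-k_2\vec h$ (prime is $d/ds$) for functions $k_1,k_2$. Standing assumption: the derivatives of the frame vectors are non-null and $N$ is non-cylindrical; in particular $k_1\neq0$ and $k_1^2\neq k_2^2$ everywhere. The unit tangent of $\vec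 c$ is $\vec c\,'=\vec t=\cosh\theta\,\vec q+\sinh\theta\,\vec a$ for a real function $\theta$ (the hyperbolic angle between $\vec t$ and $\vec q$). $\alpha$-transversal surface. For a function $\alpha:I\to\mathbb{R}$, $N^\alpha$ is the ruled surface $\vec r_\alpha(s,v)=\vec c(s)+v\vec q_\alpha(s)$ with $\vec q_\alpha=\mu\vec q+\eta\vec h$, where either $(\mu,\eta)=(\cosh\alpha,\sinh\alpha)$ on all of $I$ ($\vec q_\alpha$ timelike) or $(\mu,\eta)=(\sinh\alpha,\cosh\alpha)$ on all of $I$ ($\vec q_\alpha$ spacelike); it is assumed that $\mu\ne0$ and $\eta\neq0$ everywhere and that $\langle\vec q_\alpha',\vec q_\alpha'\rangle\neq0$ everywhere. Its striction curve is $\vec c_\alpha=\vec c+v_\alpha\vec q_\alpha$ with $v_\alpha=-\langle\vec c\,',\vec q_\alpha'\rangle/\langle\vec q_\alpha',\vec q_\alpha'\rangle$; it coincides with $\vec c$ if $v_\alpha=0$ on $I$. The curve $\vec c$ is a geodesic on $N$ if $\vec h$ and $\vec c\,''$ are linearly dependent at every $s\in I$. *)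

theory Defs
  imports "HOL-Analysis.Analysis"
begin

text \<open>The underlying vector space is real^3; the derivatives and the topology used below are
  the usual (Euclidean) ones.\<close>

definition mink :: "real^3 \<Rightarrow> real^3 \<Rightarrow> real" where
  "mink x y = - (x$1 * y$1) + x$2 * y$2 + x$3 * y$3"

text \<open>By convention the zero vector has no causal character; in particular it is not null.\<close>

definition timelike :: "real^3 \<Rightarrow> bool" where
  "timelike x \<longleftrightarrow> x \<noteq> 0 \<and> mink x x < 0"

definition null_vector :: "real^3 \<Rightarrow> bool" where
  "null_vector x \<longleftrightarrow> x \<noteq> 0 \<and> mink x x = 0"

definition velocity :: "(real \<Rightarrow> 'a::real_normed_vector) \<Rightarrow> real \<Rightarrow> 'a" where
  "velocity f s = vector_derivative f (at s)"

definition smooth_on :: "real set \<Rightarrow> (real \<Rightarrow> 'a::real_normed_vector) \<Rightarrow> bool" where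
  "smooth_on I f \<longleftrightarrow> (\<forall>n. \<forall>s\<in>I. (velocity ^^ n) f differentiable (at s))"

definition open_interval :: "real set \<Rightarrow> bool" where
  "open_interval I \<longleftrightarrow> I \<noteq> {} \<and> open I \<and> is_interval I"

definition ruled_surface ::
  "(real \<Rightarrow> real^3) \<Rightarrow> (real \<Rightarrow> real^3) \<Rightarrow> real \<Rightarrow> real \<Rightarrow> real^3" where
  "ruled_surface c q s v = c s + v *\<^sub>R q s"

definition partial_s :: "(real \<Rightarrow> real \<Rightarrow> real^3) \<Rightarrow> real \<Rightarrow> real \<Rightarrow> real^3" where
  "partial_s r s v = velocity (\<lambda>u. r u v) s"

definition partial_v :: "(real \<Rightarrow> real \<Rightarrow> real^3) \<Rightarrow> real \<Rightarrow> real \<Rightarrow> real^3" where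
  "partial_v r s v = velocity (\<lambda>w. r s w) v"

text \<open>The family formulation is used, rather than the library's notion for sets, because the
  set containing the two vectors collapses to a singleton when they are equal.\<close>

definition lin_dependent2 :: "real^3 \<Rightarrow> real^3 \<Rightarrow> bool" where
  "lin_dependent2 x y \<longleftrightarrow> (\<exists>m n :: real. (m, n) \<noteq> (0, 0) \<and> m *\<^sub>R x + n *\<^sub>R y = 0)"

text \<open>A surface is timelike if the induced metric is Lorentzian, i.e. has negative Gram
  determinant, at every regular point. A ruled surface may have singular points.\<close>

definition timelike_surface :: "real set \<Rightarrow> (real \<Rightarrow> real \<Rightarrow> real^3) \<Rightarrow> bool" where
  "timelike_surface I r \<longleftrightarrow>
    (\<forall>s\<in>I. \<forall>v. \<not> lin_dependent2 (partial_s r s v) (partial_v r s v) \<longrightarrow>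
      mink (partial_s r s v) (partial_s r s v) * mink (partial_v r s v) (partial_v r s v)
        - (mink (partial_s r s v) (partial_v r s v))\<^sup>2 < 0)"

text \<open>The parameter value on the ruling at which the striction point lies.\<close>

definition striction_parameter ::
  "(real \<Rightarrow> real^3) \<Rightarrow> (real \<Rightarrow> real^3) \<Rightarrow> real \<Rightarrow> real" where
  "striction_parameter c q s =
    - mink (velocity c s) (velocity q s) / mink (velocity q s) (velocity q s)"

definition striction_curve ::
  "(real \<Rightarrow> real^3) \<Rightarrow> (real \<Rightarrow> real^3) \<Rightarrow> real \<Rightarrow> real^3" where
  "striction_curve c q s = c s + striction_parameter c q s *\<^sub>R q s"

definition frenet_frame ::
  "real set \<Rightarrow> (real \<Rightarrow> real^3) \<Rightarrow> (real \<Rightarrow> real^3) \<Rightarrow> (real \<Rightarrow> real^3)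
    \<Rightarrow> (real \<Rightarrow> real) \<Rightarrow> (real \<Rightarrow> real) \<Rightarrow> bool" where
  "frenet_frame I q h a k1 k2 \<longleftrightarrow>
    (\<forall>s\<in>I.
      mink (q s) (q s) = -1 \<and> mink (h s) (h s) = 1 \<and> mink (a s) (a s) = 1 \<and>
      mink (q s) (h s) = 0 \<and> mink (q s) (a s) = 0 \<and> mink (h s) (a s) = 0 \<and>
      (q has_vector_derivative k1 s *\<^sub>R h s) (at s) \<and>
      (h has_vector_derivative k1 s *\<^sub>R q s + k2 s *\<^sub>R a s) (at s) \<and>
      (a has_vector_derivative - k2 s *\<^sub>R h s) (at s))"

text \<open>The surface is the one parametrized by ruled_surface c q. Its base curve c is required to
  be its own striction curve, h is normal to the surface along c, and theta is the hyperbolic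
  angle between the unit tangent of c and the ruling. Non-cylindrical means that the derivative
  of the ruling direction does not vanish; together with the derivatives of the frame vectors
  not being null, this gives that k1 is nonzero and that k1 and k2 have different squares.
  The case that k2 vanishes somewhere is not excluded here, nor is sinh theta = 0.\<close>

definition timelike_ruled_Nminus ::
  "real set \<Rightarrow> (real \<Rightarrow> real^3) \<Rightarrow> (real \<Rightarrow> real^3) \<Rightarrow> (real \<Rightarrow> real^3) \<Rightarrow> (real \<Rightarrow> real^3)
    \<Rightarrow> (real \<Rightarrow> real) \<Rightarrow> (real \<Rightarrow> real) \<Rightarrow> (real \<Rightarrow> real) \<Rightarrow> bool" where
  "timelike_ruled_Nminus I c q h a k1 k2 \<theta> \<longleftrightarrow>
    smooth_on I c \<and> smooth_on I q \<and> smooth_on I h \<and> smooth_on I a \<and>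
    smooth_on I k1 \<and> smooth_on I k2 \<and> smooth_on I \<theta> \<and>
    timelike_surface I (ruled_surface c q) \<and>
    (\<forall>s\<in>I. timelike (q s)) \<and>
    (\<forall>s\<in>I. striction_curve c q s = c s) \<and>
    (\<forall>s\<in>I. timelike (velocity c s) \<and> mink (velocity c s) (velocity c s) = -1) \<and>
    frenet_frame I q h a k1 k2 \<and>
    (\<forall>s\<in>I. mink (h s) (partial_s (ruled_surface c q) s 0) = 0 \<and>
            mink (h s) (partial_v (ruled_surface c q) s 0) = 0) \<and>
    (\<forall>s\<in>I. \<not> null_vector (velocity q s) \<and> \<not> null_vector (velocity h s) \<and>
            \<not> null_vector (velocity a s)) \<and>
    (\<forall>s\<in>I. velocity q s \<noteq> 0) \<and>
    (\<forall>s\<in>I. velocity c s = cosh (\<theta> s) *\<^sub>R q s + sinh (\<theta> s) *\<^sub>R a s)"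

text \<open>The central normal h is passed explicitly, as the surface normal along c.\<close>

definition geodesic_on_surface ::
  "real set \<Rightarrow> (real \<Rightarrow> real^3) \<Rightarrow> (real \<Rightarrow> real^3) \<Rightarrow> bool" where
  "geodesic_on_surface I h c \<longleftrightarrow> (\<forall>s\<in>I. lin_dependent2 (h s) (velocity (velocity c) s))"

definition transversal_ruling ::
  "(real \<Rightarrow> real) \<Rightarrow> (real \<Rightarrow> real) \<Rightarrow> (real \<Rightarrow> real^3) \<Rightarrow> (real \<Rightarrow> real^3) \<Rightarrow> real \<Rightarrow> real^3" where
  "transversal_ruling \<mu> \<eta> q h s = \<mu> s *\<^sub>R q s + \<eta> s *\<^sub>R h s"

text \<open>The data defining the transversal surface, which is the ruled surface with base curve c
  and ruling direction transversal_ruling mu eta q h. The first alternative is the one with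
  timelike ruling, the second the one with spacelike ruling.\<close>

definition transversal_data ::
  "real set \<Rightarrow> (real \<Rightarrow> real^3) \<Rightarrow> (real \<Rightarrow> real^3) \<Rightarrow> (real \<Rightarrow> real)
    \<Rightarrow> (real \<Rightarrow> real) \<Rightarrow> (real \<Rightarrow> real) \<Rightarrow> bool" where
  "transversal_data I q h \<alpha> \<mu> \<eta> \<longleftrightarrow>
    smooth_on I \<alpha> \<and>
    ((\<forall>s\<in>I. \<mu> s = cosh (\<alpha> s) \<and> \<eta> s = sinh (\<alpha> s)) \<or>
     (\<forall>s\<in>I. \<mu> s = sinh (\<alpha> s) \<and> \<eta> s = cosh (\<alpha> s))) \<and>
    (\<forall>s\<in>I. \<mu> s \<noteq> 0 \<and> \<eta> s \<noteq> 0) \<and>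
    (\<forall>s\<in>I. mink (velocity (transversal_ruling \<mu> \<eta> q h) s)
                 (velocity (transversal_ruling \<mu> \<eta> q h) s) \<noteq> 0)"

end

theory Submission
  imports Defs
begin

text \<open>Since $\mu' = \alpha'\eta$ and $\eta' = \alpha'\mu$ for both types of transversal ruling,
  $q_\alpha' = (\alpha'+k_1)(\eta q + \mu h) + \eta k_2 a$. Hence the two striction curves coincide
  exactly when $(\alpha'+k_1)\cosh\theta = k_2\sinh\theta$. This forces $k_2 \neq 0$ everywhere: a
  zero of $k_2$ would be a zero of $\alpha'+k_1$, hence of $q_\alpha'$. So
  $\tanh\theta = (\alpha'+k_1)/k_2$. On the other hand,
  $c'' = \theta'(\sinh\theta\,q + \cosh\theta\,a) + (k_1\cosh\theta - k_2\sinh\theta)h$, so that $c$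
  is a geodesic exactly when $\theta$ is constant.\<close>

lemma mink_commute: "mink x y = mink y x"
  by (simp add: mink_def mult.commute)

lemma mink_add_left: "mink (x + y) z = mink x z + mink y z"
  by (simp add: mink_def algebra_simps)

lemma mink_add_right: "mink z (x + y) = mink z x + mink z y"
  by (simp add: mink_def algebra_simps)

lemma mink_scaleR_left: "mink (r *\<^sub>R x) y = r * mink x y"
  by (simp add: mink_def algebra_simps)

lemma mink_scaleR_right: "mink x (r *\<^sub>R y) = r * mink x y"
  by (simp add: mink_def algebra_simps)

lemma mink_zero_left: "mink 0 x = 0"
  by (simp add: mink_def)

lemmas mink_bilinear = mink_add_left mink_add_right mink_scaleR_left mink_scaleR_right

lemma velocity_eqI: "(f has_vector_derivative D) (at s) \<Longrightarrow> velocity f s = D"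
  by (simp add: velocity_def vector_derivative_at)

lemma smooth_on_imp_DERIV:
  fixes f :: "real \<Rightarrow> real"
  assumes "smooth_on I f" "s \<in> I"
  shows "(f has_field_derivative deriv f s) (at s)"
proof -
  have "((velocity ^^ 0) f) differentiable (at s)"
    using assms unfolding smooth_on_def by blast
  then show ?thesis
    by (simp add: DERIV_deriv_iff_real_differentiable)
qed

text \<open>Each half uses a different property of the interval: convexity makes a function with
  vanishing derivative globally constant, and openness lets the values on \<open>I\<close> alone
  determine \<open>deriv\<close> at a point of \<open>I\<close>.\<close>

lemma deriv_zero_iff_constant_on:
  fixes f :: "real \<Rightarrow> real"
  assumes I: "open_interval I"
    and f: "\<And>s. s \<in> I \<Longrightarrow> (f has_field_derivative deriv f s) (at s)"
  shows "(\<forall>s\<in>I. deriv f s = 0) \<longleftrightarrow> f constant_on I"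
proof
  assume zero: "\<forall>s\<in>I. deriv f s = 0"
  have "convex I"
    using I by (simp add: open_interval_def is_interval_convex)
  moreover have "(f has_field_derivative 0) (at s within I)" if "s \<in> I" for s
    using f[OF that] zero that by (auto intro: has_field_derivative_at_within)
  ultimately have "\<exists>k. \<forall>s\<in>I. f s = k"
    using has_field_derivative_zero_constant by blast
  then show "f constant_on I"
    by (simp add: constant_on_def)
next
  assume "f constant_on I"
  then obtain k where k: "\<And>s. s \<in> I \<Longrightarrow> f s = k"
    by (auto simp: constant_on_def)
  show "\<forall>s\<in>I. deriv f s = 0"
  proof
    fix s assume s: "s \<in> I"
    have "open I"
      using I by (simp add: open_interval_def)
    then have "(f has_field_derivative 0) (at s)"
      by (rule has_field_derivative_transform_within_open[OF DERIV_const[of k] _ s]) (simp add: k)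
    then show "deriv f s = 0"
      by (rule DERIV_imp_deriv)
  qed
qed

lemma velocity_transversal_ruling:
  assumes frame: "frenet_frame I q h a k1 k2" and I: "open I"
    and \<alpha>: "transversal_data I q h \<alpha> \<mu> \<eta>" and s: "s \<in> I"
  shows "velocity (transversal_ruling \<mu> \<eta> q h) s
    = (deriv \<alpha> s + k1 s) *\<^sub>R (\<eta> s *\<^sub>R q s + \<mu> s *\<^sub>R h s) + (\<eta> s * k2 s) *\<^sub>R a s"
proof -
  have D\<alpha>: "(\<alpha> has_field_derivative deriv \<alpha> s) (at s)"
    using \<alpha> s by (auto simp: transversal_data_def intro: smooth_on_imp_DERIV)
  have Dcosh: "((\<lambda>u. cosh (\<alpha> u)) has_field_derivative deriv \<alpha> s * sinh (\<alpha> s)) (at s)"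
    by (auto intro!: derivative_eq_intros D\<alpha>)
  have Dsinh: "((\<lambda>u. sinh (\<alpha> u)) has_field_derivative deriv \<alpha> s * cosh (\<alpha> s)) (at s)"
    by (auto intro!: derivative_eq_intros D\<alpha>)
  have "(\<forall>u\<in>I. \<mu> u = cosh (\<alpha> u) \<and> \<eta> u = sinh (\<alpha> u)) \<or>
      (\<forall>u\<in>I. \<mu> u = sinh (\<alpha> u) \<and> \<eta> u = cosh (\<alpha> u))"
    using \<alpha> by (simp add: transversal_data_def)
  \<comment> \<open>Differentiation swaps cosh and sinh, so both types of ruling yield the same two
    formulas and need no separate treatment below. As \<mu> and \<eta> are prescribed only on
    \<open>I\<close>, the derivatives are transferred through the open set \<open>I\<close>.\<close>
  then have D\<mu>\<eta>: "(\<mu> has_field_derivative deriv \<alpha> s * \<eta> s) (at s) \<and>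
      (\<eta> has_field_derivative deriv \<alpha> s * \<mu> s) (at s)"
    using has_field_derivative_transform_within_open[OF Dcosh I s]
      has_field_derivative_transform_within_open[OF Dsinh I s] s
    by (elim disjE) simp_all
  have "(q has_vector_derivative k1 s *\<^sub>R h s) (at s)"
    and "(h has_vector_derivative k1 s *\<^sub>R q s + k2 s *\<^sub>R a s) (at s)"
    using frame s by (auto simp: frenet_frame_def)
  with D\<mu>\<eta> have "(transversal_ruling \<mu> \<eta> q h has_vector_derivative
      (\<mu> s *\<^sub>R k1 s *\<^sub>R h s + (deriv \<alpha> s * \<eta> s) *\<^sub>R q s) +
      (\<eta> s *\<^sub>R (k1 s *\<^sub>R q s + k2 s *\<^sub>R a s) + (deriv \<alpha> s * \<mu> s) *\<^sub>R h s)) (at s)"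
    unfolding transversal_ruling_def[abs_def]
    by (intro has_vector_derivative_add has_vector_derivative_scaleR) auto
  then show ?thesis
    by (subst velocity_eqI) (auto simp: algebra_simps)
qed

lemma velocity_velocity_striction:
  assumes N: "timelike_ruled_Nminus I c q h a k1 k2 \<theta>" and I: "open I" and s: "s \<in> I"
  shows "velocity (velocity c) s
    = deriv \<theta> s *\<^sub>R (sinh (\<theta> s) *\<^sub>R q s + cosh (\<theta> s) *\<^sub>R a s)
      + (cosh (\<theta> s) * k1 s - sinh (\<theta> s) * k2 s) *\<^sub>R h s"
proof -
  have D\<theta>: "(\<theta> has_field_derivative deriv \<theta> s) (at s)"
    using N s by (auto simp: timelike_ruled_Nminus_def intro: smooth_on_imp_DERIV)
  have "((\<lambda>u. cosh (\<theta> u)) has_field_derivative deriv \<theta> s * sinh (\<theta> s)) (at s)"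
    and "((\<lambda>u. sinh (\<theta> u)) has_field_derivative deriv \<theta> s * cosh (\<theta> s)) (at s)"
    by (auto intro!: derivative_eq_intros D\<theta>)
  moreover have "(q has_vector_derivative k1 s *\<^sub>R h s) (at s)"
    and "(a has_vector_derivative - k2 s *\<^sub>R h s) (at s)"
    using N s by (auto simp: timelike_ruled_Nminus_def frenet_frame_def)
  ultimately have "((\<lambda>u. cosh (\<theta> u) *\<^sub>R q u + sinh (\<theta> u) *\<^sub>R a u) has_vector_derivative
      (cosh (\<theta> s) *\<^sub>R k1 s *\<^sub>R h s + (deriv \<theta> s * sinh (\<theta> s)) *\<^sub>R q s) +
      (sinh (\<theta> s) *\<^sub>R (- k2 s *\<^sub>R h s) + (deriv \<theta> s * cosh (\<theta> s)) *\<^sub>R a s)) (at s)"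
    by (intro has_vector_derivative_add has_vector_derivative_scaleR)
  \<comment> \<open>The expression of c' in the frame is known only on \<open>I\<close>; openness
    makes that enough to differentiate it at s.\<close>
  then have "(velocity c has_vector_derivative
      (cosh (\<theta> s) *\<^sub>R k1 s *\<^sub>R h s + (deriv \<theta> s * sinh (\<theta> s)) *\<^sub>R q s) +
      (sinh (\<theta> s) *\<^sub>R (- k2 s *\<^sub>R h s) + (deriv \<theta> s * cosh (\<theta> s)) *\<^sub>R a s)) (at s)"
    by (rule has_vector_derivative_transform_within_open[OF _ I s])
      (use N in \<open>auto simp: timelike_ruled_Nminus_def\<close>)
  then show ?thesis
    by (subst velocity_eqI) (auto simp: algebra_simps)
qed

text \<open>Apart from a multiple of h, the acceleration is \<theta>' times a unit spacelike vector
  orthogonal to h, so only \<theta>' can obstruct dependence.\<close>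

lemma lin_dependent2_acceleration_iff:
  assumes N: "timelike_ruled_Nminus I c q h a k1 k2 \<theta>" and I: "open I" and s: "s \<in> I"
  shows "lin_dependent2 (h s) (velocity (velocity c) s) \<longleftrightarrow> deriv \<theta> s = 0"
proof
  have frame: "mink (q s) (q s) = -1" "mink (h s) (h s) = 1" "mink (a s) (a s) = 1"
      "mink (q s) (h s) = 0" "mink (q s) (a s) = 0" "mink (h s) (a s) = 0"
    using N s by (auto simp: timelike_ruled_Nminus_def frenet_frame_def)
  \<comment> \<open>This is the unit vector orthogonal to the tangent of c in the plane of q and a.
    Pairing with it kills h and reads off \<theta>' from the acceleration.\<close>
  define u where "u = sinh (\<theta> s) *\<^sub>R q s + cosh (\<theta> s) *\<^sub>R a s"
  have hu: "mink (h s) u = 0"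
    using frame by (simp add: u_def mink_bilinear mink_commute[of "h s" "q s"])
  have uu: "mink u u = 1"
    using frame
    by (simp add: u_def mink_bilinear mink_commute[of "a s" "q s"] cosh_square_eq
        flip: power2_eq_square)
  {
    assume "lin_dependent2 (h s) (velocity (velocity c) s)"
    then obtain m n where mn: "(m, n) \<noteq> (0, 0)"
      and eq: "m *\<^sub>R h s + n *\<^sub>R velocity (velocity c) s = 0"
      unfolding lin_dependent2_def by blast
    \<comment> \<open>With n = 0 the relation would reduce to m h = 0, hence m = 0, against
      nontriviality.\<close>
    have "h s \<noteq> 0"
      using frame mink_zero_left by force
    with mn eq have "n \<noteq> 0"
      by auto
    have "n * deriv \<theta> s = mink (m *\<^sub>R h s + n *\<^sub>R velocity (velocity c) s) u"
      by (simp add: velocity_velocity_striction[OF assms] mink_add_left mink_scaleR_left hu uu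
          flip: u_def)
    then have "n * deriv \<theta> s = 0"
      unfolding eq by (simp add: mink_zero_left)
    with \<open>n \<noteq> 0\<close> show "deriv \<theta> s = 0"
      by simp
  next
    assume "deriv \<theta> s = 0"
    \<comment> \<open>The acceleration is now exactly this multiple of h. The coefficient -1 keeps
      the relation nontrivial even where the multiple is zero.\<close>
    then have "(cosh (\<theta> s) * k1 s - sinh (\<theta> s) * k2 s) *\<^sub>R h s
        + (- 1) *\<^sub>R velocity (velocity c) s = 0"
      by (simp add: algebra_simps velocity_velocity_striction[OF assms])
    then show "lin_dependent2 (h s) (velocity (velocity c) s)"
      unfolding lin_dependent2_def by (metis prod.inject zero_neq_neg_one)
  }
qed

lemma tanh_angle_of_coinciding_striction:
  assumes N: "timelike_ruled_Nminus I c q h a k1 k2 \<theta>" and I: "open I"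
    and \<alpha>: "transversal_data I q h \<alpha> \<mu> \<eta>"
    and coincide: "striction_curve c (transversal_ruling \<mu> \<eta> q h) s = c s"
    and s: "s \<in> I"
  shows "k2 s \<noteq> 0" and "deriv \<alpha> s + k1 s = tanh (\<theta> s) * k2 s"
proof -
  let ?p = "transversal_ruling \<mu> \<eta> q h"
  have N_frame: "frenet_frame I q h a k1 k2"
    using N by (simp add: timelike_ruled_Nminus_def)
  then have frame: "mink (q s) (q s) = -1" "mink (h s) (h s) = 1" "mink (a s) (a s) = 1"
      "mink (q s) (h s) = 0" "mink (q s) (a s) = 0" "mink (h s) (a s) = 0"
    using s by (auto simp: frenet_frame_def)
  note p' = velocity_transversal_ruling[OF N_frame I \<alpha> s]
  have \<mu>: "\<mu> s \<noteq> 0" and \<eta>: "\<eta> s \<noteq> 0"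
    and p'_nonzero: "mink (velocity ?p s) (velocity ?p s) \<noteq> 0"
    using \<alpha> s by (auto simp: transversal_data_def)
  \<comment> \<open>Coincidence of the curves only says that striction parameter times ruling is
    zero. The ruling is nonzero because its product with q is nonzero, so the parameter vanishes;
    its denominator is nonzero, hence its numerator is zero.\<close>
  have "mink (?p s) (q s) = - \<mu> s"
    using frame by (simp add: transversal_ruling_def mink_bilinear mink_commute[of "h s" "q s"])
  then have "?p s \<noteq> 0"
    using \<mu> mink_zero_left by force
  then have "mink (velocity c s) (velocity ?p s) = 0"
    using coincide p'_nonzero by (simp add: striction_curve_def striction_parameter_def)
  moreover have "velocity c s = cosh (\<theta> s) *\<^sub>R q s + sinh (\<theta> s) *\<^sub>R a s"
    using N s by (simp add: timelike_ruled_Nminus_def)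
  \<comment> \<open>The tangent of c has no h component, so only the q and a components of the
    derivative of the ruling contribute; both carry the factor \<eta>, which cancels.\<close>
  ultimately have "\<eta> s * (sinh (\<theta> s) * k2 s - cosh (\<theta> s) * (deriv \<alpha> s + k1 s)) = 0"
    using frame
    by (simp add: p' mink_bilinear mink_commute[of "a s" "q s"] mink_commute[of "a s" "h s"]
        algebra_simps)
  with \<eta> have "sinh (\<theta> s) * k2 s = cosh (\<theta> s) * (deriv \<alpha> s + k1 s)"
    by simp
  then show eq: "deriv \<alpha> s + k1 s = tanh (\<theta> s) * k2 s"
    by (simp add: tanh_def field_simps)
  show "k2 s \<noteq> 0"
  proof
    assume "k2 s = 0"
    with eq have "velocity ?p s = 0"
      by (simp add: p')
    with p'_nonzero show False
      by (simp add: mink_zero_left)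
  qed
qed

theorem theorem4p3:
  fixes I :: "real set"
    and c q h a :: "real \<Rightarrow> real^3"
    and k1 k2 \<theta> \<alpha> \<mu> \<eta> :: "real \<Rightarrow> real"
  assumes "open_interval I"
    and "timelike_ruled_Nminus I c q h a k1 k2 \<theta>"
    and "transversal_data I q h \<alpha> \<mu> \<eta>"
    and "\<forall>s\<in>I. striction_curve c (transversal_ruling \<mu> \<eta> q h) s = c s"
  shows "geodesic_on_surface I h c \<longleftrightarrow>
    (\<exists>x::real. \<forall>s\<in>I. deriv \<alpha> s = x * k2 s - k1 s)"
proof -
  have I: "open I"
    using assms(1) by (simp add: open_interval_def)
  have "smooth_on I \<theta>"
    using assms(2) by (simp add: timelike_ruled_Nminus_def)
  then have "(\<forall>s\<in>I. deriv \<theta> s = 0) \<longleftrightarrow> \<theta> constant_on I"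
    by (intro deriv_zero_iff_constant_on[OF assms(1)] smooth_on_imp_DERIV)
  then have geodesic: "geodesic_on_surface I h c \<longleftrightarrow> \<theta> constant_on I"
    by (simp add: geodesic_on_surface_def lin_dependent2_acceleration_iff[OF assms(2) I])
  have k2: "k2 s \<noteq> 0" and tanh: "deriv \<alpha> s + k1 s = tanh (\<theta> s) * k2 s" if "s \<in> I" for s
    using tanh_angle_of_coinciding_striction[OF assms(2) I assms(3) _ that] assms(4) that
    by auto
  \<comment> \<open>Cancelling the nowhere vanishing \<open>k2\<close> gives an equivalence at each
    s with the same x on both sides, so the quantifiers carry over unchanged.\<close>
  have slope: "deriv \<alpha> s = x * k2 s - k1 s \<longleftrightarrow> tanh (\<theta> s) = x" if "s \<in> I" for s x
  proof -
    have "deriv \<alpha> s = x * k2 s - k1 s \<longleftrightarrow> tanh (\<theta> s) * k2 s = x * k2 s"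
      using tanh[OF that] by linarith
    with k2[OF that] show ?thesis
      by simp
  qed
  \<comment> \<open>tanh is injective on the reals with left inverse \<open>artanh\<close>, so a
    constant value x of tanh \<theta> forces \<theta> to be \<open>artanh x\<close>. No bound on x
    has to be imposed, since x is itself a value of tanh.\<close>
  have "\<theta> constant_on I \<longleftrightarrow> (\<exists>x. \<forall>s\<in>I. tanh (\<theta> s) = x)"
    unfolding constant_on_def by (metis artanh_tanh_real)
  then show ?thesis
    by (simp add: geodesic slope)
qed

end
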